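(* Consider the trading prophets problem with fixed additive transaction cost $\epsilon>0$ (defined in the context). Then, for any fixed $k$, any online algorithm whose decisions at time step $t$ are based only on the prices in the next $k$ time steps cannot have a bounded competitive ratio. This holds even if at time step $t$ the algorithm is given the realizations of the prices at time steps $t+1,\dots,t+k$.
   Context: Trading prophets problem with additive transaction cost $\epsilon>0$: there is a sequence of non-negative prices $X_1,\dots,X_T$ (independent random variables with known distributions, possibly deterministic). At each time $i$ a trader holding at most one unit of stock at any time may buy one unit at price $X_i+\epsilon$ (if not holding) or sell its unit at price $X_i-\epsilon$ (if holding); profit is total sale revenue minus total purchase cost. $\mathrm{ALG}$ is the profit of the algorithm and $\mathrm{OPT}$ the maximum profit achievable under the same rules by an offline prophet knowing all prices in advance. An algorithm is $\alpha$-competitive if $\mathbb{E}[\mathrm{OPT}]\le\alpha\,\mathbb{E}[\mathrm{ALG}]+c$ for a constant $c$ independent of $T$; it has bounded competitive ratio if it is $\alpha$-competitive for some finite $\alpha$. *)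

theory Defs
  imports "HOL-Probability.Probability"
begin

text \<open>
  Time steps are \<open>1, \<dots>, T\<close>; \<open>holding a t\<close> says whether the trader owns the unit of stock
  after step \<open>t\<close>.  At most one action is taken per time step.
\<close>

datatype action = Buy | Sell | Idle

primrec holding :: "(nat \<Rightarrow> action) \<Rightarrow> nat \<Rightarrow> bool" where
  "holding a 0 = False"
| "holding a (Suc t) =
     (case a (Suc t) of Buy \<Rightarrow> True | Sell \<Rightarrow> False | Idle \<Rightarrow> holding a t)"

definition feasible :: "nat \<Rightarrow> (nat \<Rightarrow> action) \<Rightarrow> bool" where
  "feasible T a \<longleftrightarrow>
     (\<forall>t\<in>{1..T}. (a t = Buy \<longrightarrow> \<not> holding a (t - 1)) \<and> (a t = Sell \<longrightarrow> holding a (t - 1)))"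

definition profit :: "real \<Rightarrow> nat \<Rightarrow> (nat \<Rightarrow> real) \<Rightarrow> (nat \<Rightarrow> action) \<Rightarrow> real" where
  "profit \<epsilon> T x a =
     (\<Sum>t=1..T. case a t of Buy \<Rightarrow> - (x t + \<epsilon>) | Sell \<Rightarrow> x t - \<epsilon> | Idle \<Rightarrow> 0)"

definition OPT :: "real \<Rightarrow> nat \<Rightarrow> (nat \<Rightarrow> real) \<Rightarrow> real" where
  "OPT \<epsilon> T x = Max {profit \<epsilon> T x a | a. feasible T a}"

lemma finite_profits: "finite {profit \<epsilon> T x a | a. feasible T a}"
proof -
  have fin: "finite ((\<lambda>a. profit \<epsilon> T x a) ` (PiE {1..T} (\<lambda>_. {Buy, Sell, Idle})))"
    by (intro finite_imageI finite_PiE) auto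
  have "profit \<epsilon> T x a \<in> (\<lambda>a. profit \<epsilon> T x a) ` (PiE {1..T} (\<lambda>_. {Buy, Sell, Idle}))" for a
  proof (rule image_eqI)
    show "profit \<epsilon> T x a = profit \<epsilon> T x (restrict a {1..T})"
      unfolding profit_def by (intro sum.cong) auto
    have "b \<in> {Buy, Sell, Idle}" for b
      by (cases b) auto
    then show "restrict a {1..T} \<in> PiE {1..T} (\<lambda>_. {Buy, Sell, Idle})"
      by auto
  qed
  then show ?thesis
    by (intro finite_subset[OF _ fin]) auto
qed

lemma feasible_Idle: "feasible T (\<lambda>_. Idle)"
  by (simp add: feasible_def)

lemma OPT_attained: "\<exists>a. feasible T a \<and> OPT \<epsilon> T x = profit \<epsilon> T x a"
proof -
  have "{profit \<epsilon> T x a | a. feasible T a} \<noteq> {}"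
    using feasible_Idle by blast
  from Max_in[OF finite_profits this] show ?thesis
    unfolding OPT_def by blast
qed

lemma profit_le_OPT: "feasible T a \<Longrightarrow> profit \<epsilon> T x a \<le> OPT \<epsilon> T x"
  unfolding OPT_def by (intro Max_ge[OF finite_profits]) blast

text \<open>
  An instance is a horizon \<open>T\<close> and the distributions \<open>D 1, \<dots>, D T\<close> of the prices.  The prices
  are independent: their joint law is the product measure.  Deterministic prices are the case
  \<open>D i = return borel x\<close>.
\<close>

definition price_instance :: "nat \<Rightarrow> (nat \<Rightarrow> real measure) \<Rightarrow> bool" where
  "price_instance T D \<longleftrightarrow>
     (\<forall>i\<in>{1..T}. prob_space (D i) \<and> sets (D i) = sets borel \<and>
        (AE x in D i. 0 \<le> x) \<and> integrable (D i) (\<lambda>x. x))"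

abbreviation price_law :: "nat \<Rightarrow> (nat \<Rightarrow> real measure) \<Rightarrow> (nat \<Rightarrow> real) measure" where
  "price_law T D \<equiv> PiM {1..T} D"

text \<open>
  \<open>A T D x r t\<close> is the action at step \<open>t\<close> for the distributions \<open>D\<close>, the realized prices
  \<open>x\<close> and the internal random seed \<open>r\<close>, which is drawn from \<open>R\<close> independently of the prices;
  deterministic algorithms ignore \<open>r\<close>.
\<close>

type_synonym 'r algorithm =
  "nat \<Rightarrow> (nat \<Rightarrow> real measure) \<Rightarrow> (nat \<Rightarrow> real) \<Rightarrow> 'r \<Rightarrow> nat \<Rightarrow> action"

text \<open>
  Besides \<open>T\<close>, \<open>r\<close> and the past, the action at step \<open>t\<close> may depend only on the prices at steps
  \<open>t, \<dots>, t + k\<close>, on their distributions as well as on their realizations.  The last conjunct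
  makes the expected profit of the algorithm meaningful.
\<close>

definition lookahead_algorithm :: "nat \<Rightarrow> 'r measure \<Rightarrow> 'r algorithm \<Rightarrow> bool" where
  "lookahead_algorithm k R A \<longleftrightarrow>
     (\<forall>T D x r. price_instance T D \<longrightarrow> r \<in> space R \<longrightarrow> feasible T (A T D x r)) \<and>
     (\<forall>T D D' x x' r. \<forall>t\<in>{1..T}.
        price_instance T D \<longrightarrow> price_instance T D' \<longrightarrow> r \<in> space R \<longrightarrow>
        (\<forall>i\<in>{1..T}. i \<le> t + k \<longrightarrow> D i = D' i \<and> x i = x' i) \<longrightarrow>
        A T D x r t = A T D' x' r t) \<and>
     (\<forall>T D. \<forall>t\<in>{1..T}. price_instance T D \<longrightarrow>
        (\<lambda>(x, r). A T D x r t) \<in> price_law T D \<Otimes>\<^sub>M R \<rightarrow>\<^sub>M count_space UNIV)"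

definition expected_ALG ::
  "real \<Rightarrow> 'r measure \<Rightarrow> 'r algorithm \<Rightarrow> nat \<Rightarrow> (nat \<Rightarrow> real measure) \<Rightarrow> real" where
  "expected_ALG \<epsilon> R A T D = (LINT (x, r)|(price_law T D \<Otimes>\<^sub>M R). profit \<epsilon> T x (A T D x r))"

definition expected_OPT :: "real \<Rightarrow> nat \<Rightarrow> (nat \<Rightarrow> real measure) \<Rightarrow> real" where
  "expected_OPT \<epsilon> T D = (LINT x|price_law T D. OPT \<epsilon> T x)"

definition competitive :: "real \<Rightarrow> 'r measure \<Rightarrow> 'r algorithm \<Rightarrow> real \<Rightarrow> bool" where
  "competitive \<epsilon> R A \<alpha> \<longleftrightarrow>
     (\<exists>c. \<forall>T D. price_instance T D \<longrightarrow>
        expected_OPT \<epsilon> T D \<le> \<alpha> * expected_ALG \<epsilon> R A T D + c)"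

definition bounded_competitive_ratio :: "real \<Rightarrow> 'r measure \<Rightarrow> 'r algorithm \<Rightarrow> bool" where
  "bounded_competitive_ratio \<epsilon> R A \<longleftrightarrow> (\<exists>\<alpha>\<ge>0. competitive \<epsilon> R A \<alpha>)"

end

(*
  The instances are deterministic paths of a random walk with steps d = \<epsilon> / (k + 1) and -d.
  Delaying all decisions of an algorithm by k steps costs at most d per step of delay and trade,
  which is less than the transaction costs.  The delayed holding pattern no longer depends on the
  increment it is exposed to, so its gain averages to 0 over all paths: on average no algorithm
  with lookahead k makes a profit.  The prophet gains (2k + 3) d - 2 \<epsilon> = d on every block
  of 2k + 3 consecutive up-steps, and the expected number of such blocks is linear in T.
*)
theory Submission
  imports Defs
begin

section \<open>Profit in terms of the holding pattern\<close>

abbreviation stock :: "(nat \<Rightarrow> action) \<Rightarrow> nat \<Rightarrow> real" where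
  "stock a t \<equiv> of_bool (holding a t)"

text \<open>Abel summation. It turns cash flows of trades into gains of the held stock over the
  price increments; \<open>h T * x T\<close> is the value of what is left unsold at the end.\<close>

lemma summation_by_parts:
  fixes h x :: "nat \<Rightarrow> real"
  assumes "h 0 = 0"
  shows "(\<Sum>t<T. x (Suc t) * (h t - h (Suc t))) = (\<Sum>t<T. h t * (x (Suc t) - x t)) - h T * x T"
  using assms by (induction T) (auto simp: algebra_simps)

text \<open>Feasibility forces every \<open>Buy\<close> to raise the stock from 0 to 1 and every
  \<open>Sell\<close> to lower it from 1 to 0, so the change of stock determines the cash
  flow.\<close>

lemma profit_eq_trades:
  assumes "feasible T a"
  shows "profit \<epsilon> T x a =
    (\<Sum>t<T. x (Suc t) * (stock a t - stock a (Suc t)) - \<epsilon> * \<bar>stock a (Suc t) - stock a t\<bar>)"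
proof -
  have "profit \<epsilon> T x a =
      (\<Sum>t<T. case a (Suc t) of Buy \<Rightarrow> - (x (Suc t) + \<epsilon>) | Sell \<Rightarrow> x (Suc t) - \<epsilon> | Idle \<Rightarrow> 0)"
    unfolding profit_def One_nat_def by (rule sum.atLeast1_atMost_eq)
  also have "\<dots> =
      (\<Sum>t<T. x (Suc t) * (stock a t - stock a (Suc t)) - \<epsilon> * \<bar>stock a (Suc t) - stock a t\<bar>)"
  proof (rule sum.cong)
    fix t assume "t \<in> {..<T}"
    then have "Suc t \<in> {1..T}"
      by auto
    with assms have "(a (Suc t) = Buy \<longrightarrow> \<not> holding a t) \<and> (a (Suc t) = Sell \<longrightarrow> holding a t)"
      unfolding feasible_def by (metis diff_Suc_1)
    then show "(case a (Suc t) of Buy \<Rightarrow> - (x (Suc t) + \<epsilon>) | Sell \<Rightarrow> x (Suc t) - \<epsilon> | Idle \<Rightarrow> 0) =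
        x (Suc t) * (stock a t - stock a (Suc t)) - \<epsilon> * \<bar>stock a (Suc t) - stock a t\<bar>"
      by (auto split: action.splits)
  qed simp
  finally show ?thesis .
qed

text \<open>The value \<open>x 0\<close> is not a price of the instance; it enters only with the
  factor \<open>stock a 0 = 0\<close>.\<close>

lemma profit_eq_increments:
  assumes "feasible T a"
  shows "profit \<epsilon> T x a =
    (\<Sum>t<T. stock a t * (x (Suc t) - x t)) - stock a T * x T
      - \<epsilon> * (\<Sum>t<T. \<bar>stock a (Suc t) - stock a t\<bar>)"
  unfolding profit_eq_trades[OF assms] sum_subtractf sum_distrib_left[symmetric]
  by (simp only: summation_by_parts[of "stock a" x T] holding.simps(1) of_bool_eq)

text \<open>Recovers actions from a desired holding pattern, so that the prophet's strategy can be
  given by the times at which it holds.\<close>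

definition actions_of :: "(nat \<Rightarrow> bool) \<Rightarrow> nat \<Rightarrow> action" where
  "actions_of h t = (if h t = h (t - 1) then Idle else if h t then Buy else Sell)"

lemma holding_actions_of: "\<not> h 0 \<Longrightarrow> holding (actions_of h) t = h t"
  by (induction t) (auto simp: actions_of_def)

lemma feasible_actions_of: "\<not> h 0 \<Longrightarrow> feasible T (actions_of h)"
  by (simp add: feasible_def holding_actions_of) (simp add: actions_of_def)

lemma holding_cong: "(\<And>i. i \<in> {1..t} \<Longrightarrow> a i = b i) \<Longrightarrow> holding a t = holding b t"
  by (induction t) (auto split: action.splits)

lemma profit_cong:
  assumes "\<And>t. t \<in> {1..T} \<Longrightarrow> x t = y t \<and> a t = b t"
  shows "profit \<epsilon> T x a = profit \<epsilon> T y b"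
  unfolding profit_def by (rule sum.cong[OF refl], drule assms) (auto split: action.split)

lemma OPT_cong: "(\<And>t. t \<in> {1..T} \<Longrightarrow> x t = y t) \<Longrightarrow> OPT \<epsilon> T x = OPT \<epsilon> T y"
  unfolding OPT_def using profit_cong[of T x y] by metis

lemma abs_profit_le:
  assumes "\<epsilon> > 0"
  shows "\<bar>profit \<epsilon> T x a\<bar> \<le> (\<Sum>t=1..T. \<bar>x t\<bar> + \<epsilon>)"
proof -
  have "\<bar>profit \<epsilon> T x a\<bar> \<le>
      (\<Sum>t=1..T. \<bar>case a t of Buy \<Rightarrow> - (x t + \<epsilon>) | Sell \<Rightarrow> x t - \<epsilon> | Idle \<Rightarrow> 0\<bar>)"
    unfolding profit_def by (rule sum_abs)
  also have "\<dots> \<le> (\<Sum>t=1..T. \<bar>x t\<bar> + \<epsilon>)"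
    using assms by (intro sum_mono) (auto split: action.splits)
  finally show ?thesis .
qed

section \<open>Random walk prices\<close>

text \<open>A path is encoded by the set \<open>U\<close> of its up-steps; a uniformly random path
  on \<open>T\<close> steps becomes the average over \<open>Pow {..<T}\<close>. Step
  \<open>t\<close> leads from time \<open>t\<close> to time \<open>t + 1\<close>.\<close>

definition step :: "nat set \<Rightarrow> nat \<Rightarrow> real" where
  "step U t = (if t \<in> U then 1 else - 1)"

text \<open>The starting value \<open>d * T\<close> keeps the prices nonnegative up to time
  \<open>T\<close>, even if all steps go down.\<close>

definition walk :: "real \<Rightarrow> nat \<Rightarrow> nat set \<Rightarrow> nat \<Rightarrow> real" where
  "walk d T U t = d * (real T + (\<Sum>i<t. step U i))"

lemma walk_increment: "walk d T U (Suc t) - walk d T U t = d * step U t"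
  by (simp add: walk_def algebra_simps)

lemma profit_walk_eq:
  assumes "feasible T a"
  shows "profit \<epsilon> T (walk d S U) a = d * (\<Sum>t<T. stock a t * step U t) - stock a T * walk d S U T
    - \<epsilon> * (\<Sum>t<T. \<bar>stock a (Suc t) - stock a t\<bar>)"
  unfolding profit_eq_increments[OF assms] walk_increment
  by (simp only: sum_distrib_left mult.left_commute)

lemma walk_nonneg:
  assumes "d \<ge> 0" "t \<le> T"
  shows "walk d T U t \<ge> 0"
proof -
  have "(\<Sum>i<t. - 1) \<le> (\<Sum>i<t. step U i)"
    by (intro sum_mono) (auto simp: step_def)
  with assms show ?thesis
    by (auto simp: walk_def)
qed

lemma walk_cong:
  assumes "\<And>i. i < t \<Longrightarrow> i \<in> U \<longleftrightarrow> i \<in> V"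
  shows "walk d T U t = walk d T V t"
proof -
  have "step U i = step V i" if "i < t" for i
    using assms[OF that] by (simp add: step_def)
  then show ?thesis
    by (simp add: walk_def)
qed

section \<open>No algorithm profits on average\<close>

text \<open>Truncated subtraction makes the term at \<open>t = 0\<close> vanish, so the left side is
  the variation of \<open>h\<close> without its last change.\<close>

lemma variation_lag_le:
  fixes h :: "nat \<Rightarrow> real"
  shows "(\<Sum>t<T. \<bar>h t - h (t - 1)\<bar>) \<le> (\<Sum>t<T. \<bar>h (Suc t) - h t\<bar>)"
proof (cases T)
  case (Suc n)
  have "(\<Sum>t<Suc n. \<bar>h t - h (t - 1)\<bar>) = (\<Sum>t<n. \<bar>h (Suc t) - h t\<bar>)"
    by (subst sum.lessThan_Suc_shift) simp
  then show ?thesis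
    using Suc by simp
qed simp

text \<open>A delay by one step changes the gain by at most the variation of \<open>h\<close>,
  because \<bar>s t\<bar> \<le> 1. The delayed pattern has no larger variation, so the induction can
  continue with it in place of \<open>h\<close>.\<close>

lemma lag_cost:
  fixes h s :: "nat \<Rightarrow> real"
  assumes "\<And>t. \<bar>s t\<bar> \<le> 1"
  shows "(\<Sum>t<T. h t * s t) \<le> (\<Sum>t<T. h (t - j) * s t) + j * (\<Sum>t<T. \<bar>h (Suc t) - h t\<bar>)"
proof (induction j arbitrary: h)
  case (Suc j)
  let ?h = "\<lambda>t. h (t - 1)"
  have "h t * s t \<le> ?h t * s t + \<bar>h t - ?h t\<bar>" for t
  proof -
    have "(h t - ?h t) * s t \<le> \<bar>h t - ?h t\<bar> * \<bar>s t\<bar>"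
      by (metis abs_ge_self abs_mult)
    also have "\<dots> \<le> \<bar>h t - ?h t\<bar>"
      using assms[of t] by (simp add: mult_left_le)
    finally show ?thesis
      by (simp add: algebra_simps)
  qed
  then have "(\<Sum>t<T. h t * s t) \<le> (\<Sum>t<T. ?h t * s t + \<bar>h t - ?h t\<bar>)"
    by (rule sum_mono)
  also have "\<dots> \<le> (\<Sum>t<T. ?h t * s t) + (\<Sum>t<T. \<bar>h (Suc t) - h t\<bar>)"
    using variation_lag_le[of h T] by (simp add: sum.distrib)
  also have "(\<Sum>t<T. ?h t * s t) \<le>
      (\<Sum>t<T. ?h (t - j) * s t) + j * (\<Sum>t<T. \<bar>?h (Suc t) - ?h t\<bar>)"
    by (rule Suc.IH)
  also have "j * (\<Sum>t<T. \<bar>?h (Suc t) - ?h t\<bar>) \<le> j * (\<Sum>t<T. \<bar>h (Suc t) - h t\<bar>)"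
    using variation_lag_le[of h T] by (intro mult_left_mono) auto
  finally show ?case
    by (simp add: algebra_simps)
qed simp

lemma profit_walk_le:
  fixes k :: nat
  assumes "feasible T a" "\<epsilon> > 0"
  defines "d \<equiv> \<epsilon> / (real k + 1)"
  shows "profit \<epsilon> T (walk d T U) a \<le> d * (\<Sum>t<T. stock a (t - k) * step U t)"
proof -
  let ?V = "\<Sum>t<T. \<bar>stock a (Suc t) - stock a t\<bar>"
  \<comment> \<open>The choice of \<open>d\<close> serves the second bound: a delay by
    \<open>k\<close> steps loses at most \<open>d * k\<close> per trade, which the transaction cost
    of that trade covers.\<close>
  have d: "d \<ge> 0" "d * k \<le> \<epsilon>"
    using assms by (auto simp: field_simps)
  \<comment> \<open>Dropping the term of the unsold stock only increases the value, as the final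
    price is nonnegative.\<close>
  have "profit \<epsilon> T (walk d T U) a \<le> d * (\<Sum>t<T. stock a t * step U t) - \<epsilon> * ?V"
    using walk_nonneg[of d T T U] d profit_walk_eq[OF assms(1)] by simp
  also have "(\<Sum>t<T. stock a t * step U t) \<le> (\<Sum>t<T. stock a (t - k) * step U t) + k * ?V"
    by (rule lag_cost) (simp add: step_def)
  also have "d * ((\<Sum>t<T. stock a (t - k) * step U t) + k * ?V) - \<epsilon> * ?V \<le>
      d * (\<Sum>t<T. stock a (t - k) * step U t)"
    using mult_right_mono[OF d(2), of ?V] by (simp add: algebra_simps sum_nonneg)
  finally show ?thesis
    using d by (simp add: mult_left_mono)
qed

text \<open>Flipping the membership of \<open>t\<close> is an involution on the paths that preserves
  \<open>f\<close> and negates the step at \<open>t\<close>, so the terms cancel in pairs.\<close>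

lemma sum_predictable_step:
  fixes f :: "nat set \<Rightarrow> real"
  assumes "t < T" and "\<And>U V. (\<And>i. i < t \<Longrightarrow> i \<in> U \<longleftrightarrow> i \<in> V) \<Longrightarrow> f U = f V"
  shows "(\<Sum>U\<in>Pow {..<T}. f U * step U t) = 0"
proof -
  let ?flip = "\<lambda>U. if t \<in> U then U - {t} else insert t U"
  have "(\<Sum>U\<in>Pow {..<T}. f U * step U t) = (\<Sum>U\<in>Pow {..<T}. - (f U * step U t))"
  proof (rule sum.reindex_bij_witness[of _ ?flip ?flip])
    fix U
    have "f (?flip U) = f U"
      by (rule assms(2)) auto
    then show "- (f (?flip U) * step (?flip U) t) = f U * step U t"
      by (auto simp: step_def)
  qed (use assms(1) in \<open>auto split: if_splits\<close>)
  then show ?thesis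
    by (simp add: sum_negf)
qed

lemma sum_profit_walk_le_0:
  fixes k :: nat
  assumes "\<epsilon> > 0" and "\<And>U. feasible T (a U)"
    and predictable: "\<And>U V t. t \<in> {1..T} \<Longrightarrow> (\<And>i. i < t + k \<Longrightarrow> i \<in> U \<longleftrightarrow> i \<in> V) \<Longrightarrow>
      a U t = a V t"
  defines "d \<equiv> \<epsilon> / (real k + 1)"
  shows "(\<Sum>U\<in>Pow {..<T}. profit \<epsilon> T (walk d T U) (a U)) \<le> 0"
proof -
  have "(\<Sum>U\<in>Pow {..<T}. profit \<epsilon> T (walk d T U) (a U)) \<le>
      (\<Sum>U\<in>Pow {..<T}. d * (\<Sum>t<T. stock (a U) (t - k) * step U t))"
    unfolding d_def using assms(1,2) by (intro sum_mono profit_walk_le)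
  also have "\<dots> = d * (\<Sum>t<T. \<Sum>U\<in>Pow {..<T}. stock (a U) (t - k) * step U t)"
    by (subst sum.swap) (simp add: sum_distrib_left)
  also have "(\<Sum>U\<in>Pow {..<T}. stock (a U) (t - k) * step U t) = 0" if "t < T" for t
  proof (rule sum_predictable_step[OF that])
    fix U V assume eq: "\<And>i. i < t \<Longrightarrow> i \<in> U \<longleftrightarrow> i \<in> V"
    \<comment> \<open>The delayed position is the result of actions at times \<open>i\<close> with
      \<open>i + k \<le> t\<close>, which see only steps before \<open>t\<close>. For
      \<open>t \<le> k\<close> it is the empty initial position.\<close>
    have "holding (a U) (t - k) = holding (a V) (t - k)"
    proof (rule holding_cong)
      fix i assume "i \<in> {1..t - k}"
      then show "a U i = a V i"
        using that eq by (intro predictable) auto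
    qed
    then show "stock (a U) (t - k) = stock (a V) (t - k)"
      by simp
  qed
  then have "d * (\<Sum>t<T. \<Sum>U\<in>Pow {..<T}. stock (a U) (t - k) * step U t) = 0"
    by simp
  finally show ?thesis .
qed

section \<open>The prophet profits linearly on average\<close>

text \<open>The time axis is cut into groups of \<open>Suc m\<close> steps. The first step of each
  group is left out, which gives the prophet an empty position between consecutive blocks.\<close>

definition rising_block :: "nat \<Rightarrow> nat \<Rightarrow> nat set" where
  "rising_block m g = {g * Suc m<..g * Suc m + m}"

lemma OPT_walk_ge:
  assumes "m > 0"
  shows "(d * m - 2 * \<epsilon>) * (\<Sum>g<N. of_bool (rising_block m g \<subseteq> U))
    \<le> OPT \<epsilon> (N * Suc m) (walk d T U)"
proof -
  define q where "q = Suc m"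
  define good where "good g \<longleftrightarrow> rising_block m g \<subseteq> U" for g
  \<comment> \<open>In a good group \<open>g\<close> the prophet buys at time
    \<open>g * q + 1\<close> and sells at time \<open>(g + 1) * q\<close>. The gap at multiples of
    \<open>q\<close> makes the groups independent: no time carries both a sale and a purchase, and
    nothing is held at the end.\<close>
  define h where "h t \<longleftrightarrow> t mod q \<noteq> 0 \<and> good (t div q)" for t
  let ?a = "actions_of h"
  let ?H = "\<lambda>t. of_bool (h t) :: real"
  have h0: "\<not> h 0" and hT: "\<not> h (N * q)"
    by (simp_all add: h_def)
  have h_in: "h (i + g * q) \<longleftrightarrow> i \<noteq> 0 \<and> good g" if "i < q" for g i
    using that by (simp add: h_def)
  have h_end: "\<not> h (q + g * q)" for g
    by (simp add: h_def)
  have group: "(\<Sum>t<N * q. f t) = (\<Sum>g<N. \<Sum>i<q. f (i + g * q))" for f :: "nat \<Rightarrow> real"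
    using sum.shift_bounds_nat_ivl[of f 0 _ q]
    by (simp add: sum.nat_group[symmetric] atLeast0LessThan add.commute[of q])
  have gain: "(\<Sum>i<q. ?H (i + g * q) * step U (i + g * q)) = m * of_bool (good g)" for g
  proof -
    have "(\<Sum>i<q. ?H (i + g * q) * step U (i + g * q)) =
        (\<Sum>i<q. if i = 0 then 0 else of_bool (good g))"
    proof (rule sum.cong)
      fix i assume i: "i \<in> {..<q}"
      have "i + g * q \<in> U" if "good g" "i \<noteq> 0"
        using that i by (auto simp: good_def rising_block_def q_def)
      then show "?H (i + g * q) * step U (i + g * q) = (if i = 0 then 0 else of_bool (good g))"
        using i by (auto simp: h_in step_def)
    qed simp
    then show ?thesis
      unfolding q_def by (subst (asm) (2) sum.lessThan_Suc_shift) simp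
  qed
  have cost: "(\<Sum>i<q. \<bar>?H (Suc (i + g * q)) - ?H (i + g * q)\<bar>) = 2 * of_bool (good g)" for g
  proof -
    \<comment> \<open>The \<open>q = n + 2\<close> transitions of a group are the purchase,
      \<open>n\<close> transitions without a trade, and the sale.\<close>
    obtain n where n: "m = Suc n"
      using assms by (cases m) auto
    have mid: "\<bar>?H (Suc (Suc i + g * q)) - ?H (Suc i + g * q)\<bar> = 0" if "i < n" for i
      using h_in[of "Suc (Suc i)" g] h_in[of "Suc i" g] that by (simp add: q_def n)
    then have mid_sum: "(\<Sum>i<n. \<bar>?H (Suc (Suc i + g * q)) - ?H (Suc i + g * q)\<bar>) = 0"
      by (intro sum.neutral) blast
    have first: "\<bar>?H (Suc (0 + g * q)) - ?H (0 + g * q)\<bar> = of_bool (good g)"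
      using h_in[of "Suc 0" g] h_in[of 0 g] by (simp add: q_def n)
    have last: "\<bar>?H (Suc (Suc n + g * q)) - ?H (Suc n + g * q)\<bar> = of_bool (good g)"
      using h_in[of "Suc n" g] h_end[of g] by (simp add: q_def n)
    have "(\<Sum>i<q. \<bar>?H (Suc (i + g * q)) - ?H (i + g * q)\<bar>) =
        (\<Sum>i<Suc (Suc n). \<bar>?H (Suc (i + g * q)) - ?H (i + g * q)\<bar>)"
      by (simp only: q_def n)
    also have "\<dots> = 2 * of_bool (good g)"
      unfolding sum.lessThan_Suc_shift[of _ "Suc n"] sum.lessThan_Suc[of _ n] first last mid_sum
      by simp
    finally show ?thesis .
  qed
  have "profit \<epsilon> (N * q) (walk d T U) ?a =
      d * (\<Sum>t<N * q. ?H t * step U t) - \<epsilon> * (\<Sum>t<N * q. \<bar>?H (Suc t) - ?H t\<bar>)"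
    using hT by (simp add: profit_walk_eq feasible_actions_of[of h, OF h0] holding_actions_of[of h, OF h0] del: holding.simps)
  also have "\<dots> = (d * m - 2 * \<epsilon>) * (\<Sum>g<N. of_bool (good g))"
    unfolding group gain cost by (simp only: sum_distrib_left[symmetric]) (simp add: algebra_simps)
  finally show ?thesis
    using profit_le_OPT[OF feasible_actions_of[of h, OF h0], of \<epsilon> "N * q" "walk d T U"]
    by (simp add: good_def q_def)
qed

text \<open>Adding \<open>B\<close> embeds the subsets of \<open>A - B\<close> into the supersets of
  \<open>B\<close>. In terms of paths, prescribed up-steps \<open>B\<close> occur with probability
  at least 1 / 2 ^ \<open>card B\<close>.\<close>

lemma card_supersets_ge:
  assumes "finite A" "B \<subseteq> A"
  shows "2 ^ card A \<le> 2 ^ card B * card {U \<in> Pow A. B \<subseteq> U}"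
proof -
  have "card (Pow (A - B)) \<le> card {U \<in> Pow A. B \<subseteq> U}"
    by (rule card_inj_on_le[of "\<lambda>U. U \<union> B"]) (use assms in \<open>auto simp: inj_on_def\<close>)
  then have "2 ^ card (A - B) \<le> card {U \<in> Pow A. B \<subseteq> U}"
    using assms by (simp add: card_Pow)
  then have "2 ^ card B * 2 ^ card (A - B) \<le> 2 ^ card B * card {U \<in> Pow A. B \<subseteq> U}"
    by simp
  moreover have "card A = card B + card (A - B)"
    using assms by (metis card_Diff_subset card_mono finite_subset le_add_diff_inverse)
  ultimately show ?thesis
    by (simp add: power_add)
qed

text \<open>Linearity of expectation: each of the \<open>N\<close> blocks rises with probability at
  least 1 / 2 ^ \<open>m\<close> and then brings \<open>d * m - 2 * \<epsilon>\<close>. This gain is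
  nonnegative, so the bounds on the frequencies may be multiplied by it.\<close>

lemma sum_OPT_walk_ge:
  fixes d \<epsilon> :: real and m N :: nat
  assumes "m > 0" "d * m \<ge> 2 * \<epsilon>"
  defines "T \<equiv> N * Suc m"
  shows "(d * m - 2 * \<epsilon>) * N * 2 ^ T \<le> 2 ^ m * (\<Sum>U\<in>Pow {..<T}. OPT \<epsilon> T (walk d T U))"
proof -
  let ?c = "d * m - 2 * \<epsilon>"
  have count: "2 ^ T \<le> 2 ^ m * (\<Sum>U\<in>Pow {..<T}. of_bool (rising_block m g \<subseteq> U) :: real)"
    if "g < N" for g
  proof -
    have "Suc g * Suc m \<le> N * Suc m"
      using that by (intro mult_le_mono1) simp
    then have "rising_block m g \<subseteq> {..<T}"
      by (auto simp: rising_block_def T_def)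
    then have "2 ^ T \<le> 2 ^ m * card {U \<in> Pow {..<T}. rising_block m g \<subseteq> U}"
      using card_supersets_ge[of "{..<T}" "rising_block m g"] by (simp add: rising_block_def)
    then have "real (2 ^ T) \<le> real (2 ^ m * card {U \<in> Pow {..<T}. rising_block m g \<subseteq> U})"
      by (rule of_nat_mono)
    moreover have "Pow {..<T} \<inter> {U. rising_block m g \<subseteq> U} =
        {U \<in> Pow {..<T}. rising_block m g \<subseteq> U}"
      by auto
    ultimately show ?thesis
      by (simp add: of_bool_def sum.If_cases)
  qed
  have "?c * N * 2 ^ T = ?c * (\<Sum>g<N. (2::real) ^ T)"
    by simp
  also have "\<dots> \<le> ?c * (\<Sum>g<N. (2::real) ^ m * (\<Sum>U\<in>Pow {..<T}. of_bool (rising_block m g \<subseteq> U)))"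
    using assms(2) count by (intro mult_left_mono sum_mono) auto
  also have "\<dots> = 2 ^ m * (\<Sum>U\<in>Pow {..<T}. ?c * (\<Sum>g<N. of_bool (rising_block m g \<subseteq> U)))"
    unfolding sum_distrib_left by (subst sum.swap) (simp add: mult_ac)
  also have "\<dots> \<le> 2 ^ m * (\<Sum>U\<in>Pow {..<T}. OPT \<epsilon> T (walk d T U))"
    unfolding T_def using assms(1) by (intro mult_left_mono sum_mono OPT_walk_ge) auto
  finally show ?thesis .
qed

section \<open>Deterministic instances\<close>

definition deterministic :: "(nat \<Rightarrow> real) \<Rightarrow> nat \<Rightarrow> real measure" where
  "deterministic p i = return borel (p i)"

lemma price_instance_deterministic:
  assumes "\<And>i. i \<in> {1..T} \<Longrightarrow> p i \<ge> 0"
  shows "price_instance T (deterministic p)"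
proof -
  have "integrable (return borel y) (\<lambda>x. x)" for y :: real
  proof -
    interpret prob_space "return borel y"
      by (rule prob_space_return) simp
    show ?thesis
      by (rule integrable_const_bound[of _ "\<bar>y\<bar>"]) (auto simp: AE_return)
  qed
  moreover have "AE x in return borel (p i). 0 \<le> x" if "i \<in> {1..T}" for i
    using assms[OF that] by (subst AE_return) auto
  ultimately show ?thesis
    unfolding price_instance_def deterministic_def by (simp add: prob_space_return)
qed

lemma prob_space_price_law:
  assumes "price_instance T D"
  shows "prob_space (price_law T D)"
  using assms by (intro prob_space_PiM) (auto simp: price_instance_def)

lemma AE_price_law_deterministic:
  "AE x in price_law T (deterministic p). \<forall>i\<in>{1..T}. x i = p i"
proof (rule AE_finite_allI)
  fix i assume "i \<in> {1..T}"
  moreover have "AE y in deterministic p i. y = p i"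
    unfolding deterministic_def by (subst AE_return) auto
  ultimately show "AE x in price_law T (deterministic p). x i = p i"
    by (intro AE_PiM_component) (auto simp: deterministic_def prob_space_return)
qed simp

section \<open>Measurability and expectation of the optimum\<close>

lemma measurable_price:
  assumes "price_instance T D" "i \<in> {1..T}"
  shows "(\<lambda>x. x i) \<in> borel_measurable (price_law T D)"
proof -
  have "(\<lambda>x. x i) \<in> measurable (price_law T D) (D i)"
    using assms(2) by (rule measurable_component_singleton)
  then show ?thesis
    using assms by (simp add: price_instance_def cong: measurable_cong_sets)
qed

text \<open>Action sequences on all of \<open>nat\<close> form an infinite set, but feasibility and
  profit see only the times in \<open>{1..T}\<close>. A maximum over a finite index set gives
  measurability.\<close>

lemma OPT_eq_Max:
  "OPT \<epsilon> T x = Max ((\<lambda>a. profit \<epsilon> T x a) ` {a \<in> PiE {1..T} (\<lambda>_. {Buy, Sell, Idle}). feasible T a})"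
proof -
  have "feasible T (restrict a {1..T})" if "feasible T a" for a
  proof -
    have "holding (restrict a {1..T}) (t - 1) = holding a (t - 1)" if "t \<in> {1..T}" for t
      using that by (intro holding_cong) auto
    then show ?thesis
      using that unfolding feasible_def by (metis restrict_apply')
  qed
  moreover have "b \<in> {Buy, Sell, Idle}" for b
    by (cases b) auto
  then have "restrict a {1..T} \<in> PiE {1..T} (\<lambda>_. {Buy, Sell, Idle})" for a
    by (simp only: restrict_PiE_iff) simp
  moreover have "profit \<epsilon> T x a = profit \<epsilon> T x (restrict a {1..T})" for a
    by (rule profit_cong) simp
  ultimately have "{profit \<epsilon> T x a | a. feasible T a} =
      (\<lambda>a. profit \<epsilon> T x a) ` {a \<in> PiE {1..T} (\<lambda>_. {Buy, Sell, Idle}). feasible T a}"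
    by blast
  then show ?thesis
    unfolding OPT_def by simp
qed

lemma measurable_OPT:
  assumes "price_instance T D"
  shows "OPT \<epsilon> T \<in> borel_measurable (price_law T D)"
proof -
  have "(\<lambda>x. case b of Buy \<Rightarrow> - (x t + \<epsilon>) | Sell \<Rightarrow> x t - \<epsilon> | Idle \<Rightarrow> 0)
      \<in> borel_measurable (price_law T D)" if "t \<in> {1..T}" for t b
    using measurable_price[OF assms that] by (cases b) auto
  then have "(\<lambda>x. profit \<epsilon> T x a) \<in> borel_measurable (price_law T D)" for a
    unfolding profit_def by (intro borel_measurable_sum)
  moreover have "finite {a \<in> PiE {1..T} (\<lambda>_. {Buy, Sell, Idle}). feasible T a}"
    by (intro finite_Collect_conjI disjI1) (simp add: finite_PiE)
  ultimately show ?thesis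
    unfolding OPT_eq_Max[abs_def] by (intro borel_measurable_Max) auto
qed

lemma expected_OPT_deterministic:
  assumes "\<And>i. i \<in> {1..T} \<Longrightarrow> p i \<ge> 0"
  shows "expected_OPT \<epsilon> T (deterministic p) = OPT \<epsilon> T p"
proof -
  note inst = price_instance_deterministic[OF assms]
  interpret prob_space "price_law T (deterministic p)"
    by (rule prob_space_price_law[OF inst])
  have "AE x in price_law T (deterministic p). OPT \<epsilon> T x = OPT \<epsilon> T p"
    using AE_price_law_deterministic[of T p] by eventually_elim (auto intro: OPT_cong)
  then have "expected_OPT \<epsilon> T (deterministic p) =
      (LINT x|price_law T (deterministic p). OPT \<epsilon> T p)"
    unfolding expected_OPT_def by (intro integral_cong_AE measurable_OPT[OF inst]) auto
  then show ?thesis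
    by (simp add: prob_space del: One_nat_def)
qed

section \<open>Expected profit of the algorithm on deterministic prices\<close>

lemma distr_pair_snd:
  assumes "prob_space M" "sigma_finite_measure R"
  shows "distr (M \<Otimes>\<^sub>M R) R snd = R"
proof (rule measure_eqI)
  interpret sigma_finite_measure R by fact
  fix A assume "A \<in> sets (distr (M \<Otimes>\<^sub>M R) R snd)"
  then have A: "A \<in> sets R"
    by simp
  then have "snd -` A \<inter> space (M \<Otimes>\<^sub>M R) = space M \<times> A"
    using sets.sets_into_space by (auto simp: space_pair_measure)
  with A show "emeasure (distr (M \<Otimes>\<^sub>M R) R snd) A = emeasure R A"
    by (simp add: emeasure_distr emeasure_pair_measure_Times prob_space.emeasure_space_1[OF assms(1)])
qed simp

lemma measurable_profit_pair:
  assumes "\<And>t. t \<in> {1..T} \<Longrightarrow> (\<lambda>z. x z t) \<in> borel_measurable M"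
    and "\<And>t. t \<in> {1..T} \<Longrightarrow> (\<lambda>z. a z t) \<in> measurable M (count_space UNIV)"
  shows "(\<lambda>z. profit \<epsilon> T (x z) (a z)) \<in> borel_measurable M"
  unfolding profit_def
proof (rule borel_measurable_sum)
  fix t assume t: "t \<in> {1..T}"
  have pred: "(\<lambda>z. a z t = b) \<in> measurable M (count_space UNIV)" for b
    using measurable_compose[OF assms(2)[OF t], of "\<lambda>c. c = b"] by simp
  have "(\<lambda>z. case a z t of Buy \<Rightarrow> - (x z t + \<epsilon>) | Sell \<Rightarrow> x z t - \<epsilon> | Idle \<Rightarrow> 0) =
      (\<lambda>z. if a z t = Buy then - (x z t + \<epsilon>) else if a z t = Sell then x z t - \<epsilon> else 0)"
    by (auto split: action.splits)
  also have "\<dots> \<in> borel_measurable M"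
    using assms(1)[OF t] pred by (intro measurable_If) (auto simp: pred_def)
  finally show "(\<lambda>z. case a z t of Buy \<Rightarrow> - (x z t + \<epsilon>) | Sell \<Rightarrow> x z t - \<epsilon> | Idle \<Rightarrow> 0)
      \<in> borel_measurable M" .
qed

lemma lookahead_algorithmD:
  assumes "lookahead_algorithm k R A" "price_instance T D"
  shows "r \<in> space R \<Longrightarrow> feasible T (A T D x r)"
    and "\<lbrakk>t \<in> {1..T}; price_instance T D'; r \<in> space R;
          \<And>i. i \<in> {1..T} \<Longrightarrow> i \<le> t + k \<Longrightarrow> D i = D' i \<and> x i = x' i\<rbrakk> \<Longrightarrow> A T D x r t = A T D' x' r t"
    and "t \<in> {1..T} \<Longrightarrow>
      (\<lambda>z. A T D (fst z) (snd z) t) \<in> price_law T D \<Otimes>\<^sub>M R \<rightarrow>\<^sub>M count_space UNIV"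
  using assms unfolding lookahead_algorithm_def by (blast, blast, simp add: case_prod_beta')

lemma measurable_profit_deterministic:
  assumes "lookahead_algorithm k R A" and nonneg: "\<And>i. i \<in> {1..T} \<Longrightarrow> p i \<ge> 0"
  shows "(\<lambda>r. profit \<epsilon> T p (A T (deterministic p) p r)) \<in> borel_measurable R"
proof (rule measurable_profit_pair)
  fix t assume t: "t \<in> {1..T}"
  \<comment> \<open>Points of the product space are undefined outside \<open>{1..T}\<close>, so the
    section is taken at the restriction of \<open>p\<close>. The actions at times in
    \<open>{1..T}\<close> are the same for \<open>p\<close> itself.\<close>
  let ?D = "deterministic p" and ?p = "restrict p {1..T}"
  note inst = price_instance_deterministic[of T p, OF nonneg]
  have "?p \<in> space (price_law T ?D)"
    by (auto simp: space_PiM deterministic_def)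
  then have "(\<lambda>r. A T ?D ?p r t) \<in> measurable R (count_space UNIV)"
    using measurable_Pair2[OF lookahead_algorithmD(3)[OF assms(1) inst t]] by simp
  moreover have "A T ?D ?p r t = A T ?D p r t" if "r \<in> space R" for r
    using t inst that by (intro lookahead_algorithmD(2)[OF assms(1)]) auto
  ultimately show "(\<lambda>r. A T ?D p r t) \<in> measurable R (count_space UNIV)"
    by (simp cong: measurable_cong)
qed simp

text \<open>Almost every realization agrees with \<open>p\<close> on \<open>{1..T}\<close>, and so
  do the actions, which read no other prices. Only the seed remains random.\<close>

lemma expected_ALG_deterministic:
  assumes "prob_space R" "lookahead_algorithm k R A" and nonneg: "\<And>i. i \<in> {1..T} \<Longrightarrow> p i \<ge> 0"
  shows "expected_ALG \<epsilon> R A T (deterministic p) =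
    (LINT r|R. profit \<epsilon> T p (A T (deterministic p) p r))"
proof -
  let ?D = "deterministic p"
  let ?M = "price_law T ?D"
  let ?g = "\<lambda>r. profit \<epsilon> T p (A T ?D p r)"
  interpret R: prob_space R by fact
  note inst = price_instance_deterministic[of T p, OF nonneg]
  note pM = prob_space_price_law[OF inst]
  note g = measurable_profit_deterministic[where T = T and p = p and \<epsilon> = \<epsilon>, OF assms(2) nonneg]
  have "AE x in distr (?M \<Otimes>\<^sub>M R) ?M fst. \<forall>i\<in>{1..T}. x i = p i"
    by (simp only: R.distr_pair_fst AE_price_law_deterministic)
  then have "AE z in ?M \<Otimes>\<^sub>M R. \<forall>i\<in>{1..T}. fst z i = p i"
    by (rule AE_distrD[OF measurable_fst])
  then have ae: "AE z in ?M \<Otimes>\<^sub>M R. profit \<epsilon> T (fst z) (A T ?D (fst z) (snd z)) = ?g (snd z)"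
    \<comment> \<open>The information condition applies only to seeds in
      \<open>space R\<close>.\<close>
    using AE_space
  proof eventually_elim
    case (elim z)
    then show ?case
      by (intro profit_cong conjI lookahead_algorithmD(2)[OF assms(2) inst _ inst])
        (auto simp: space_pair_measure)
  qed
  have "expected_ALG \<epsilon> R A T ?D = (LINT z|(?M \<Otimes>\<^sub>M R). profit \<epsilon> T (fst z) (A T ?D (fst z) (snd z)))"
    unfolding expected_ALG_def by (simp add: case_prod_beta')
  also have "\<dots> = (LINT z|(?M \<Otimes>\<^sub>M R). ?g (snd z))"
  proof (rule integral_cong_AE[OF _ _ ae])
    show "(\<lambda>z. profit \<epsilon> T (fst z) (A T ?D (fst z) (snd z))) \<in> borel_measurable (?M \<Otimes>\<^sub>M R)"
      using measurable_compose[OF measurable_fst measurable_price[OF inst]]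
        lookahead_algorithmD(3)[OF assms(2) inst]
      by (intro measurable_profit_pair) auto
    show "(\<lambda>z. ?g (snd z)) \<in> borel_measurable (?M \<Otimes>\<^sub>M R)"
      using measurable_compose[OF measurable_snd g] by simp
  qed
  also have "\<dots> = (LINT r|(distr (?M \<Otimes>\<^sub>M R) R snd). ?g r)"
    by (rule integral_distr[symmetric]) (use g in auto)
  also have "\<dots> = (LINT r|R. ?g r)"
    by (simp only: distr_pair_snd[OF pM R.sigma_finite_measure_axioms])
  finally show ?thesis .
qed

text \<open>For a fixed seed the algorithm is a deterministic strategy with lookahead
  \<open>k\<close>, whose total over all paths is at most 0; integration over the seed preserves
  this.\<close>

lemma sum_expected_ALG_walk_le_0:
  assumes "\<epsilon> > 0" "prob_space R" "lookahead_algorithm k R A"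
  defines "d \<equiv> \<epsilon> / (real k + 1)"
  shows "(\<Sum>U\<in>Pow {..<T}. expected_ALG \<epsilon> R A T (deterministic (walk d T U))) \<le> 0"
proof -
  interpret R: prob_space R by fact
  let ?x = "walk d T"
  let ?a = "\<lambda>r U. A T (deterministic (?x U)) (?x U) r"
  have nonneg: "?x U i \<ge> 0" if "i \<in> {1..T}" for U i
    using that assms(1) by (intro walk_nonneg) (auto simp: d_def)
  note inst = price_instance_deterministic[of T, OF nonneg]
  have int: "integrable R (\<lambda>r. profit \<epsilon> T (?x U) (?a r U))" for U
  proof (rule R.integrable_const_bound)
    show "AE r in R. norm (profit \<epsilon> T (?x U) (?a r U)) \<le> (\<Sum>t=1..T. \<bar>?x U t\<bar> + \<epsilon>)"
      by (rule AE_I2) (simp only: real_norm_def abs_profit_le[OF assms(1)])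
  qed (rule measurable_profit_deterministic[OF assms(3) nonneg])
  have "(\<Sum>U\<in>Pow {..<T}. profit \<epsilon> T (?x U) (?a r U)) \<le> 0" if r: "r \<in> space R" for r
    unfolding d_def
  proof (rule sum_profit_walk_le_0[OF assms(1)], fold d_def)
    show "feasible T (?a r U)" for U
      using lookahead_algorithmD(1)[OF assms(3) inst r] .
    fix U V t assume t: "t \<in> {1..T}" and eq: "\<And>i. i < t + k \<Longrightarrow> i \<in> U \<longleftrightarrow> i \<in> V"
    show "?a r U t = ?a r V t"
    proof (rule lookahead_algorithmD(2)[OF assms(3) inst t inst r])
      \<comment> \<open>Prices up to time \<open>t + k\<close> reveal exactly the steps below
        \<open>t + k\<close>. Since the distributions are point masses, they reveal no more than the
        prices.\<close>
      fix i assume "i \<le> t + k"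
      then have "?x U i = ?x V i"
        using eq by (intro walk_cong) auto
      then show "deterministic (?x U) i = deterministic (?x V) i \<and> ?x U i = ?x V i"
        by (simp add: deterministic_def)
    qed
  qed
  then have "(LINT r|R. (\<Sum>U\<in>Pow {..<T}. profit \<epsilon> T (?x U) (?a r U))) \<le> (LINT r|R. 0)"
    using int by (intro integral_mono) auto
  moreover have "expected_ALG \<epsilon> R A T (deterministic (?x U)) =
      (LINT r|R. profit \<epsilon> T (?x U) (?a r U))" for U
    by (rule expected_ALG_deterministic[OF assms(2,3) nonneg])
  ultimately show ?thesis
    using int by simp
qed

section \<open>Contradiction between the two averages\<close>

theorem theorem3:
  fixes \<epsilon> :: real and k :: nat and R :: "'r measure" and A :: "'r algorithm"
  assumes "\<epsilon> > 0"
    and "prob_space R"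
    and "lookahead_algorithm k R A"
  shows "\<not> bounded_competitive_ratio \<epsilon> R A"
proof
  assume "bounded_competitive_ratio \<epsilon> R A"
  then obtain \<alpha> c where "\<alpha> \<ge> 0" and comp: "\<And>T D. price_instance T D \<Longrightarrow>
      expected_OPT \<epsilon> T D \<le> \<alpha> * expected_ALG \<epsilon> R A T D + c"
    unfolding bounded_competitive_ratio_def competitive_def by blast
  define d where "d = \<epsilon> / (real k + 1)"
  \<comment> \<open>The least block length with \<open>d * m > 2 * \<epsilon>\<close>.\<close>
  define m where "m = 2 * k + 3"
  have "d > 0" and margin: "d * m - 2 * \<epsilon> = d"
    using assms(1) by (auto simp: d_def m_def field_simps)
  \<comment> \<open>So many groups that the lower bound \<open>N * d / 2 ^ m\<close> for the
    prophet's average exceeds the additive constant \<open>c\<close>.\<close>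
  obtain N :: nat where N: "2 ^ m * c < N * d"
    using reals_Archimedean3[OF \<open>d > 0\<close>] by blast
  define T where "T = N * Suc m"
  let ?x = "walk d T"
  have nonneg: "?x U i \<ge> 0" if "i \<in> {1..T}" for U i
    using that \<open>d > 0\<close> by (intro walk_nonneg) auto
  have "d * N * 2 ^ T \<le> 2 ^ m * (\<Sum>U\<in>Pow {..<T}. OPT \<epsilon> T (?x U))"
    using sum_OPT_walk_ge[of m \<epsilon> d N] margin \<open>d > 0\<close> by (simp add: T_def m_def)
  also have "(\<Sum>U\<in>Pow {..<T}. OPT \<epsilon> T (?x U)) \<le>
      (\<Sum>U\<in>Pow {..<T}. \<alpha> * expected_ALG \<epsilon> R A T (deterministic (?x U)) + c)"
    using comp[OF price_instance_deterministic[OF nonneg]]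
    by (intro sum_mono) (simp only: expected_OPT_deterministic[OF nonneg])
  also have "\<dots> = \<alpha> * (\<Sum>U\<in>Pow {..<T}. expected_ALG \<epsilon> R A T (deterministic (?x U))) + 2 ^ T * c"
    by (simp add: sum.distrib sum_distrib_left card_Pow)
  \<comment> \<open>As \<alpha> \<ge> 0, the nonpositive total of the algorithm contributes nothing
    positive, however large \<alpha> is.\<close>
  also have "\<dots> \<le> 2 ^ T * c"
    using sum_expected_ALG_walk_le_0[OF assms, of T] \<open>\<alpha> \<ge> 0\<close>
    by (simp add: d_def mult_nonneg_nonpos)
  finally have "d * N * 2 ^ T \<le> 2 ^ m * c * 2 ^ T"
    by (simp add: mult_ac)
  then show False
    using N by (simp add: mult.commute)
qed

end
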